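(* For every integer $k\ge 6$ there exists a connected graph $G$ with $\mathrm{mpd}(G)=k$.
   Context: Graphs are finite, simple and undirected; $d(u,v)$ denotes the shortest-path distance. Let $G$ be a connected graph and let $\Pi=\{S_1,\dots,S_t\}$ be a partition of $V(G)$ into nonempty parts. For $v\in V(G)$ put $d(v,S_i)=\min\{d(v,x):x\in S_i\}$. The multiset partition representation of $v$ with respect to $\Pi$ is the multiset $r_{mp}(v\mid\Pi)=\{d(v,S_1),\dots,d(v,S_t)\}$ (order ignored, multiplicities kept). $\Pi$ is a resolving multiset partition if $r_{mp}(u\mid\Pi)\ne r_{mp}(v\mid\Pi)$ for all distinct $u,v\in V(G)$. The multiset partition dimension $\mathrm{mpd}(G)$ is the minimum number $t$ of parts of a resolving multiset partition of $G$, and $\mathrm{mpd}(G)=\infty$ if none exists. *)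

theory Defs
  imports
    "Graph_Theory.Graph_Theory"
    "HOL-Library.Multiset"
    "HOL-Library.Disjoint_Sets"
    "HOL-Library.Extended_Nat"
begin

text \<open>
  A finite simple undirected graph is a \<^locale>\<open>pair_graph\<close>: a finite digraph whose arc set is a
  symmetric, loop-free relation on the vertex set.
\<close>

text \<open>
  The number of edges on a shortest walk; it is \<open>\<infinity>\<close> when there is none, which
  does not occur in connected graphs.
\<close>

definition graph_dist :: "'a pair_pre_digraph \<Rightarrow> 'a \<Rightarrow> 'a \<Rightarrow> ereal" where
  "graph_dist G u v = wf_digraph.\<mu> (with_proj G) (\<lambda>_. 1) u v"

definition dist_to_part :: "'a pair_pre_digraph \<Rightarrow> 'a \<Rightarrow> 'a set \<Rightarrow> ereal" where
  "dist_to_part G v S = Min {graph_dist G v x | x. x \<in> S}"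

definition mp_representation :: "'a pair_pre_digraph \<Rightarrow> 'a set set \<Rightarrow> 'a \<Rightarrow> ereal multiset" where
  "mp_representation G P v = image_mset (dist_to_part G v) (mset_set P)"

definition resolving_multiset_partition :: "'a pair_pre_digraph \<Rightarrow> 'a set set \<Rightarrow> bool" where
  "resolving_multiset_partition G P \<longleftrightarrow>
     partition_on (pverts G) P \<and>
     (\<forall>u \<in> pverts G. \<forall>v \<in> pverts G.
        u \<noteq> v \<longrightarrow> mp_representation G P u \<noteq> mp_representation G P v)"

text \<open>The infimum of the empty set in \<^typ>\<open>enat\<close> is \<open>\<infinity>\<close>.\<close>

definition mpd :: "'a pair_pre_digraph \<Rightarrow> enat" where
  "mpd G = Inf {enat (card P) | P. resolving_multiset_partition G P}"

end

theory Submission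
  imports Defs
begin

text \<open>
  If \<open>A\<close> collects parts at distance at most 2 from every vertex of \<open>U\<close>, each vertex of \<open>U\<close> lies in
  a member of \<open>A\<close>, and all vertices of \<open>U\<close> agree on their distances to the remaining parts, then
  the representation of \<open>u \<in> U\<close> depends only on its number of ones coming from \<open>A\<close>, which is less
  than \<open>|A|\<close>; so \<open>|U| \<le> |A|\<close>.

  The witness for \<open>k = m + 2\<close> has a clique \<open>x\<^sub>0, \<dots>, x\<^sub>m\<close> joined to a hub from which a path
  hub -- stem -- tip hangs, and vertices \<open>y\<^sub>1, \<dots>, y\<^sub>m\<close> with \<open>x\<^sub>i \<sim> y\<^sub>j\<close> iff \<open>j \<le> i\<close>. The \<open>k\<close> vertices
  \<open>x\<^sub>i\<close> and \<open>y\<^sub>1\<close> are within distance 2 of everything but stem and tip, from which the \<open>x\<^sub>i\<close> are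
  equidistant. If every part leaves \<open>{stem, tip}\<close>, apply the bound to all \<open>k\<close> of them; otherwise
  apply it to the \<open>k - 1\<close> vertices \<open>x\<^sub>i\<close>, where \<open>A\<close> misses a part. Either way \<open>k\<close> parts are needed.

  In the other direction, take the parts \<open>{tip}\<close>, \<open>{x\<^sub>i} \<union> {hub, stem, bridge}\<close>, \<open>{y\<^sub>1, twin}\<close> and
  \<open>{y\<^sub>j}\<close>. The distance to the tip tells the \<open>x\<^sub>i\<close> from the \<open>y\<^sub>i\<close>, and both \<open>x\<^sub>i\<close> and \<open>y\<^sub>i\<close> see exactly
  \<open>i\<close> other parts at distance 1. For the \<open>y\<^sub>i\<close> this needs a graph with distinct degrees, which does
  not exist among simple graphs: it is the threshold graph \<open>i + j \<ge> m + 2\<close> in which each loop \<open>2i \<ge>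
  m + 2\<close> is replaced by an edge from \<open>y\<^sub>i\<close> to the twin of \<open>y\<^sub>1\<close>. The bridge keeps the twin within
  distance 2 of \<open>x\<^sub>0\<close>.
\<close>

section \<open>Distances to parts: walks and potentials\<close>

lemma dist_to_part_eqI:
  assumes "pair_graph G" "S \<subseteq> pverts G" "s \<in> S" "pre_digraph.awalk (with_proj G) u p s"
    and min: "\<And>x q. x \<in> S \<Longrightarrow> pre_digraph.awalk (with_proj G) u q x \<Longrightarrow> length p \<le> length q"
  shows "dist_to_part G u S = ereal (real (length p))"
proof -
  interpret pair_graph G by fact
  have gd: "graph_dist G u x = (INF q\<in>{q. awalk u q x}. ereal (real (length q)))" for x
    unfolding graph_dist_def \<mu>_def awalk_cost_def
    by (simp add: map_replicate_const sum_list_replicate)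
  have fin: "finite {graph_dist G u x | x. x \<in> S}"
    using finite_subset[OF assms(2) pair_finite_verts] by (simp add: setcompr_eq_image)
  have lower: "ereal (real (length p)) \<le> graph_dist G u x" if "x \<in> S" for x
    unfolding gd using min[OF that] by (auto intro!: INF_greatest)
  have "graph_dist G u s = ereal (real (length p))"
    by (rule antisym) (use lower assms(3,4) in \<open>auto simp: gd intro!: INF_lower2\<close>)
  then show ?thesis
    unfolding dist_to_part_def
    by (intro Min_eqI fin) (use lower assms(3) in \<open>force+\<close>)
qed

text \<open>A shortest walk into \<open>S\<close> exists by well-ordering, and a walk of length zero
  stays at \<open>u\<close>; this turns explicit short walks into the nearness hypothesis of the
  counting bound.\<close>

lemma dist_to_part_le_walk:
  assumes "pair_graph G" "S \<subseteq> pverts G" "s \<in> S" "pre_digraph.awalk (with_proj G) u p s"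
  shows "\<exists>n \<le> length p. dist_to_part G u S = ereal (real n) \<and> (n = 0 \<longleftrightarrow> u \<in> S)"
proof -
  interpret pair_graph G by fact
  let ?R = "\<lambda>n. \<exists>x\<in>S. \<exists>q. awalk u q x \<and> length q = n"
  define n where "n = (LEAST n. ?R n)"
  have "?R (length p)"
    using assms by blast
  then have "?R n" "n \<le> length p"
    unfolding n_def by (rule LeastI, rule Least_le)
  then obtain x q where q: "x \<in> S" "awalk u q x" "length q = n"
    by blast
  have least: "n \<le> length q'" if "y \<in> S" "awalk u q' y" for y q'
    unfolding n_def using that by (intro Least_le) blast
  have "n = 0" if "u \<in> S"
    using least[OF that, of "[]"] assms(2) that by (auto simp: awalk_Nil_iff)
  moreover have "u \<in> S" if "n = 0"
    using q that by (auto simp: awalk_Nil_iff)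
  moreover have "dist_to_part G u S = ereal (real n)"
    using dist_to_part_eqI[OF assms(1,2) q(1,2)] least q(3) by simp
  ultimately show ?thesis
    using \<open>n \<le> length p\<close> by blast
qed

text \<open>Since \<open>h\<close> drops by at most one per arc, no walk into its zero set is
  shorter than \<open>h v\<close>; always stepping to a smaller value gives a walk of that length.
  Distances are thus certified by local checks.\<close>

lemma dist_to_part_eq_potential:
  fixes h :: "'a \<Rightarrow> nat"
  assumes "pair_graph G" "S \<subseteq> pverts G" "v \<in> pverts G"
    and zero: "\<And>v. v \<in> pverts G \<Longrightarrow> h v = 0 \<longleftrightarrow> v \<in> S"
    and lip: "\<And>u v. (u, v) \<in> parcs G \<Longrightarrow> h u \<le> Suc (h v)"
    and dec: "\<And>v. v \<in> pverts G \<Longrightarrow> h v \<noteq> 0 \<Longrightarrow> \<exists>w. (v, w) \<in> parcs G \<and> h v = Suc (h w)"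
  shows "dist_to_part G v S = ereal (real (h v))"
    and "\<exists>s\<in>S. \<exists>p. pre_digraph.awalk (with_proj G) v p s"
proof -
  interpret pair_graph G by fact
  have walk: "\<exists>s\<in>S. \<exists>p. awalk v p s \<and> length p = h v" if "v \<in> pverts G" for v
    using that
  proof (induction "h v" arbitrary: v)
    case 0
    then show ?case
      using zero[of v] by (auto simp: awalk_Nil_iff intro!: bexI[of _ v])
  next
    case (Suc n)
    then obtain w where w: "(v, w) \<in> parcs G" "h v = Suc (h w)"
      using dec[of v] by auto
    with Suc obtain s p where "s \<in> S" "awalk w p s" "length p = h w"
      by (metis Suc_inject in_arcsD2)
    with w show ?case
      by (intro bexI[of _ s] exI[of _ "(v, w) # p"]) (auto simp: awalk_Cons_iff)
  qed
  have low: "h v \<le> length q + h x" if "awalk v q x" for v q x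
    using that
  proof (induction q arbitrary: v)
    case (Cons e q)
    then have "(v, snd e) \<in> parcs G" "awalk (snd e) q x"
      by (auto simp: awalk_Cons_iff)
    with Cons.IH[of "snd e"] lip[of v "snd e"] show ?case
      by simp
  qed (simp add: awalk_Nil_iff)
  obtain s p where p: "s \<in> S" "awalk v p s" "length p = h v"
    using walk[OF assms(3)] by blast
  then show "\<exists>s\<in>S. \<exists>p. awalk v p s"
    by blast
  have "length p \<le> length q" if "x \<in> S" "awalk v q x" for x q
    using low[OF that(2)] zero[of x] that(1) assms(2) p(3) by auto
  from dist_to_part_eqI[OF assms(1,2) p(1,2) this] p(3)
  show "dist_to_part G v S = ereal (real (h v))"
    by simp
qed

section \<open>Counting bound for vertices near all parts of a family\<close>

lemma card_le_card_near_parts: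
  assumes res: "resolving_multiset_partition G P" and "finite P" "A \<subseteq> P" "U \<subseteq> pverts G"
    and own: "\<And>u. u \<in> U \<Longrightarrow> \<exists>S\<in>A. u \<in> S"
    and near: "\<And>u S. u \<in> U \<Longrightarrow> S \<in> A \<Longrightarrow>
      \<exists>n \<le> 2. dist_to_part G u S = ereal (real n) \<and> (n = 0 \<longleftrightarrow> u \<in> S)"
    and const: "\<And>u v S. u \<in> U \<Longrightarrow> v \<in> U \<Longrightarrow> S \<in> P - A \<Longrightarrow>
      dist_to_part G u S = dist_to_part G v S"
  shows "card U \<le> card A"
proof -
  let ?d = "dist_to_part G"
  have finA: "finite A"
    using assms(2,3) by (rule finite_subset[rotated])
  define f where "f u = card {S\<in>A. ?d u S = 1}" for u
  \<comment> \<open>The zero comes from the part containing the vertex, which is unique; the parts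
    of \<open>A\<close> at distance neither 0 nor 1 all contribute 2.\<close>
  define r where "r n = {#0::ereal#} + replicate_mset n 1 + replicate_mset (card A - 1 - n) 2" for n
  have repA: "image_mset (?d u) (mset_set A) = r (f u)" and f_less: "f u < card A"
    if u: "u \<in> U" for u
  proof -
    obtain S0 where S0: "S0 \<in> A" "u \<in> S0"
      using own[OF u] by blast
    have uniq: "S = S0" if "S \<in> A" "u \<in> S" for S
      using res that S0 assms(3) partition_onD2[of "pverts G" P]
      unfolding resolving_multiset_partition_def disjoint_def by blast
    have val: "?d u S = 0 \<and> u \<in> S \<or> ?d u S = 1 \<and> u \<notin> S \<or> ?d u S = 2 \<and> u \<notin> S" if S: "S \<in> A" for S
    proof -
      obtain n where n: "n \<le> 2" "?d u S = ereal (real n)" "n = 0 \<longleftrightarrow> u \<in> S"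
        using near[OF u S] by blast
      from n(1) consider "n = 0" | "n = 1" | "n = 2"
        by linarith
      then show ?thesis
        using n(2,3) by cases (auto simp: zero_ereal_def one_ereal_def)
    qed
    let ?A1 = "{S\<in>A. ?d u S = 1}" and ?A2 = "{S\<in>A. ?d u S = 2}"
    have A: "A = {S0} \<union> ?A1 \<union> ?A2"
      using val uniq S0 by blast
    have fin: "finite ?A1" "finite ?A2"
      using finA by auto
    have d0: "?d u S0 = 0"
      using val[OF S0(1)] S0(2) by simp
    have disj: "S0 \<notin> ?A1" "S0 \<notin> ?A2" "?A1 \<inter> ?A2 = {}"
      using d0 by auto
    have "card A = card ({S0} \<union> ?A1 \<union> ?A2)"
      using A by simp
    also have "\<dots> = 1 + card ?A1 + card ?A2"
      using fin disj by (subst card_Un_disjoint; auto)+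
    finally have cA: "card A = 1 + f u + card ?A2"
      unfolding f_def .
    then show "f u < card A"
      by simp
    have "mset_set A = mset_set ({S0} \<union> ?A1 \<union> ?A2)"
      using A by simp
    also have "\<dots> = {#S0#} + mset_set ?A1 + mset_set ?A2"
      using fin disj by (subst mset_set_Union; auto)+
    finally have "image_mset (?d u) (mset_set A) = {#?d u S0#} +
        image_mset (?d u) (mset_set ?A1) + image_mset (?d u) (mset_set ?A2)"
      by simp
    moreover have "image_mset (?d u) (mset_set ?A1) = image_mset (\<lambda>_. 1) (mset_set ?A1)"
      by (rule image_mset_cong) (use fin in auto)
    moreover have "image_mset (?d u) (mset_set ?A2) = image_mset (\<lambda>_. 2) (mset_set ?A2)"
      by (rule image_mset_cong) (use fin in auto)
    ultimately show "image_mset (?d u) (mset_set A) = r (f u)"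
      using cA d0 by (simp add: r_def f_def image_mset_const_eq)
  qed
  have rep: "mp_representation G P u = r (f u) + image_mset (?d u) (mset_set (P - A))"
    if "u \<in> U" for u
  proof -
    have "mset_set P = mset_set A + mset_set (P - A)"
      using assms(2,3) finA by (subst mset_set_Union[symmetric]) (auto simp: Un_absorb1)
    then show ?thesis
      unfolding mp_representation_def using repA[OF that] by simp
  qed
  have "inj_on f U"
  proof (rule inj_onI, rule ccontr)
    fix u v assume uv: "u \<in> U" "v \<in> U" "f u = f v" "u \<noteq> v"
    have "image_mset (?d u) (mset_set (P - A)) = image_mset (?d v) (mset_set (P - A))"
      by (rule image_mset_cong) (use const[OF uv(1,2)] assms(2) in auto)
    with uv rep have "mp_representation G P u = mp_representation G P v"
      by simp
    with res uv assms(4) show False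
      unfolding resolving_multiset_partition_def by blast
  qed
  moreover have "f ` U \<subseteq> {..<card A}"
    using f_less by blast
  ultimately show ?thesis
    using card_inj_on_le[of f U "{..<card A}"] by simp
qed

section \<open>The witness graph and its distances\<close>

datatype vertex = Stem | Tip | Hub | Twin | Bridge | Clique nat | Fan nat

instance vertex :: countable
  by countable_datatype

definition vertices :: "nat \<Rightarrow> vertex set" where
  "vertices m = {Stem, Tip, Hub, Twin, Bridge} \<union> Clique ` {..m} \<union> Fan ` {1..m}"

text \<open>Edges between different constructors are listed in one orientation only, which halves
  the case analyses; \<open>adj\<close> restores symmetry.\<close>

fun half_adj :: "nat \<Rightarrow> vertex \<Rightarrow> vertex \<Rightarrow> bool" where
  "half_adj m Tip Stem = True"
| "half_adj m Stem Hub = True"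
| "half_adj m Hub (Clique i) = True"
| "half_adj m (Clique i) (Clique j) = (i \<noteq> j)"
| "half_adj m (Clique i) (Fan j) = (j \<le> i)"
| "half_adj m (Clique i) Bridge = (i = 0)"
| "half_adj m (Fan i) (Fan j) = (i \<noteq> j \<and> m + 2 \<le> i + j)"
| "half_adj m Twin (Fan j) = (j = 1 \<or> m + 2 \<le> 2 * j)"
| "half_adj m Twin Bridge = True"
| "half_adj m _ _ = False"

definition adj :: "nat \<Rightarrow> vertex \<Rightarrow> vertex \<Rightarrow> bool" where
  "adj m u v \<longleftrightarrow> half_adj m u v \<or> half_adj m v u"

definition witness :: "nat \<Rightarrow> nat pair_pre_digraph" where
  "witness m = \<lparr>pverts = to_nat ` vertices m,
     parcs = {(to_nat u, to_nat v) | u v. u \<in> vertices m \<and> v \<in> vertices m \<and> adj m u v}\<rparr>"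

text \<open>
  \<open>part_dist m j v\<close> is the distance from \<open>v\<close> to the \<open>j\<close>-th part: index \<open>0\<close> is the part of the
  clique, \<open>m + 1\<close> that of the tip, and \<open>1 \<le> j \<le> m\<close> that of \<open>Fan j\<close>.
\<close>

fun part_dist :: "nat \<Rightarrow> nat \<Rightarrow> vertex \<Rightarrow> nat" where
  "part_dist m j Tip = (if j = 0 then 1 else if j = m + 1 then 0 else 4)"
| "part_dist m j Stem = (if j = 0 then 0 else if j = m + 1 then 1 else 3)"
| "part_dist m j Hub = (if j = 0 then 0 else 2)"
| "part_dist m j (Clique i) = (if j = 0 then 0 else if j = m + 1 then 3 else if j \<le> i then 1 else 2)"
| "part_dist m j (Fan i) = (if j = 0 then 1 else if j = m + 1 then 4 else if j = i then 0 else
     if m + 2 \<le> (if j = 1 then 2 * i else i + j) then 1 else 2)"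
| "part_dist m j Bridge = (if j = 0 then 0 else if j = m + 1 then 4 else if j = 1 then 1 else
     if m + 2 \<le> 2 * j then 2 else 3)"
| "part_dist m j Twin = (if j = 0 then 1 else if j = m + 1 then 5 else if j = 1 then 0 else
     if m + 2 \<le> 2 * j then 1 else 2)"

text \<open>As a zero set of \<open>part_dist\<close>, each part meets the vanishing condition on
  the potential by definition.\<close>

definition part :: "nat \<Rightarrow> nat \<Rightarrow> vertex set" where
  "part m j = {v \<in> vertices m. part_dist m j v = 0}"

lemma pverts_witness [simp]: "pverts (witness m) = to_nat ` vertices m"
  by (simp add: witness_def)

lemma parcs_witness_iff [simp]:
  "(to_nat u, to_nat v) \<in> parcs (witness m) \<longleftrightarrow> u \<in> vertices m \<and> v \<in> vertices m \<and> adj m u v"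
  by (auto simp: witness_def)

lemma finite_vertices [simp]: "finite (vertices m)"
  by (simp add: vertices_def)

lemma half_adj_irrefl: "\<not> half_adj m v v"
  by (cases v) auto

lemma pair_graph_witness: "pair_graph (witness m)"
proof
  show "finite (parcs (witness m))"
    by (rule finite_subset[of _ "(to_nat ` vertices m) \<times> (to_nat ` vertices m)"]) (auto simp: witness_def)
  show "symmetric (with_proj (witness m))"
    unfolding symmetric_def by (auto simp: witness_def adj_def intro!: symI)
qed (auto simp: witness_def adj_def half_adj_irrefl)

lemma dist_to_part_witness:
  fixes h :: "vertex \<Rightarrow> nat"
  assumes "S \<subseteq> vertices m" "v \<in> vertices m"
    and "\<And>v. v \<in> vertices m \<Longrightarrow> h v = 0 \<longleftrightarrow> v \<in> S"
    and "\<And>u v. u \<in> vertices m \<Longrightarrow> v \<in> vertices m \<Longrightarrow> half_adj m u v \<Longrightarrow> h u \<le> Suc (h v) \<and> h v \<le> Suc (h u)"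
    and "\<And>v. v \<in> vertices m \<Longrightarrow> h v \<noteq> 0 \<Longrightarrow> \<exists>w\<in>vertices m. adj m v w \<and> h v = Suc (h w)"
  shows "dist_to_part (witness m) (to_nat v) (to_nat ` S) = ereal (real (h v))"
    and "\<exists>s\<in>to_nat ` S. \<exists>p. pre_digraph.awalk (with_proj (witness m)) (to_nat v) p s"
proof -
  have dec: "\<exists>w. (x, w) \<in> parcs (witness m) \<and> (h \<circ> from_nat) x = Suc ((h \<circ> from_nat) w)"
    if "x \<in> pverts (witness m)" "(h \<circ> from_nat) x \<noteq> 0" for x
  proof -
    obtain v where v: "x = to_nat v" "v \<in> vertices m" "h v \<noteq> 0"
      using \<open>x \<in> pverts (witness m)\<close> \<open>(h \<circ> from_nat) x \<noteq> 0\<close> by auto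
    then obtain w where "w \<in> vertices m" "adj m v w" "h v = Suc (h w)"
      using assms(5) by blast
    with v show ?thesis
      by (intro exI[of _ "to_nat w"]) auto
  qed
  have lip: "(h \<circ> from_nat) x \<le> Suc ((h \<circ> from_nat) y)" if "(x, y) \<in> parcs (witness m)" for x y
    using that assms(4) by (auto simp: witness_def adj_def)
  have zero: "(h \<circ> from_nat) x = 0 \<longleftrightarrow> x \<in> to_nat ` S" if "x \<in> pverts (witness m)" for x
    using that assms(1,3) by auto
  have "to_nat ` S \<subseteq> pverts (witness m)" "to_nat v \<in> pverts (witness m)"
    using assms(1,2) by auto
  note * = dist_to_part_eq_potential[OF pair_graph_witness this zero lip dec]
  from * show "dist_to_part (witness m) (to_nat v) (to_nat ` S) = ereal (real (h v))"
    and "\<exists>s\<in>to_nat ` S. \<exists>p. pre_digraph.awalk (with_proj (witness m)) (to_nat v) p s"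
    by simp_all
qed

lemma vertices_simps [simp]:
  "Stem \<in> vertices m" "Tip \<in> vertices m" "Hub \<in> vertices m" "Twin \<in> vertices m" "Bridge \<in> vertices m"
  "Clique i \<in> vertices m \<longleftrightarrow> i \<le> m" "Fan i \<in> vertices m \<longleftrightarrow> 1 \<le> i \<and> i \<le> m"
  by (auto simp: vertices_def)

lemma part_dist_lipschitz:
  assumes "3 \<le> m" "j \<le> m + 1" "u \<in> vertices m" "v \<in> vertices m" "half_adj m u v"
  shows "part_dist m j u \<le> Suc (part_dist m j v) \<and> part_dist m j v \<le> Suc (part_dist m j u)"
  using assms by (cases u; cases v) auto

lemma part_dist_descent:
  assumes "3 \<le> m" "j \<le> m + 1" "v \<in> vertices m" "part_dist m j v \<noteq> 0"
  shows "\<exists>w\<in>vertices m. adj m v w \<and> part_dist m j v = Suc (part_dist m j w)"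
proof (cases v)
  case Stem
  then show ?thesis using assms
    by (intro bexI[of _ "if j = m + 1 then Tip else Hub"]) (auto simp: adj_def split: if_splits)
next
  case Tip
  then show ?thesis using assms by (intro bexI[of _ Stem]) (auto simp: adj_def split: if_splits)
next
  case Hub
  then show ?thesis using assms
    by (intro bexI[of _ "if j = m + 1 then Stem else Clique m"]) (auto simp: adj_def split: if_splits)
next
  case Twin
  \<comment> \<open>\<open>Fan m\<close> is a neighbour of \<open>Twin\<close> because
    \<open>m + 2 \<le> 2 * m\<close>, and it is adjacent to every \<open>Fan j\<close> with
    \<open>2 \<le> j < m\<close>.\<close>
  then show ?thesis using assms
    by (intro bexI[of _ "if j = 0 \<or> j = m + 1 then Bridge else if m + 2 \<le> 2 * j then Fan j else Fan m"])
       (auto simp: adj_def split: if_splits)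
next
  case Bridge
  then show ?thesis using assms
    by (intro bexI[of _ "if j = m + 1 then Clique 0 else Twin"])
       (auto simp: adj_def split: if_splits)
next
  case (Clique i)
  then show ?thesis using assms
    by (intro bexI[of _ "if j = m + 1 then Hub else if j \<le> i then Fan j else Clique m"])
       (auto simp: adj_def split: if_splits)
next
  case (Fan i)
  \<comment> \<open>Part 1 also contains \<open>Twin\<close>, the neighbour of \<open>Fan i\<close>
    that replaces its loop. Parts not adjacent to \<open>Fan i\<close> are approached through
    \<open>Clique m\<close>, which sees the whole fan.\<close>
  then show ?thesis using assms
    by (intro bexI[of _ "if j = 0 \<or> j = m + 1 then Clique m else
          if j = 1 \<and> m + 2 \<le> 2 * i then Twin else if j \<noteq> 1 \<and> m + 2 \<le> i + j then Fan j else Clique m"])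
       (auto simp: adj_def split: if_splits)
qed

lemma dist_to_part_part:
  assumes "3 \<le> m" "j \<le> m + 1" "v \<in> vertices m"
  shows "dist_to_part (witness m) (to_nat v) (to_nat ` part m j) = ereal (real (part_dist m j v))"
  by (rule dist_to_part_witness)
     (use assms part_dist_lipschitz part_dist_descent in \<open>auto simp: part_def\<close>)

text \<open>The potential for the singleton part \<open>{Tip}\<close> yields a walk from every
  vertex to \<open>Tip\<close>; symmetry then joins any two vertices.\<close>

lemma connected_witness:
  assumes "3 \<le> m"
  shows "Digraph_Component.connected (with_proj (witness m))"
proof -
  interpret pair_graph "witness m"
    by (rule pair_graph_witness)
  have part: "part m (m + 1) = {Tip}"
    unfolding part_def vertices_def using assms by (auto split: if_splits)
  have reach: "to_nat v \<rightarrow>\<^sup>*\<^bsub>with_proj (witness m)\<^esub> to_nat Tip" if "v \<in> vertices m" for v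
  proof -
    have "\<exists>s\<in>to_nat ` part m (m + 1). \<exists>p. awalk (to_nat v) p s"
      by (rule dist_to_part_witness(2)[where h = "part_dist m (m + 1)"])
         (use that assms part_dist_lipschitz part_dist_descent in \<open>auto simp: part_def\<close>)
    then show ?thesis
      unfolding part by (auto simp: reachable_awalk)
  qed
  show ?thesis
  proof (rule connectedI)
    show "pverts (witness m) \<noteq> {}"
      by (auto simp: vertices_def)
    fix u v assume "u \<in> pverts (witness m)" "v \<in> pverts (witness m)"
    then have "u \<rightarrow>\<^sup>*\<^bsub>with_proj (witness m)\<^esub> v"
      using reach by (auto intro: reachable_trans symmetric_reachable')
    then show "u \<rightarrow>\<^sup>*\<^bsub>with_proj (mk_symmetric (with_proj (witness m)))\<^esub> v"
      by (rule reachable_mk_symmetricI)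
  qed
qed


section \<open>Upper bound: a resolving partition into \<open>m + 2\<close> parts\<close>

definition parts :: "nat \<Rightarrow> nat set set" where
  "parts m = (\<lambda>j. to_nat ` part m j) ` {..m + 1}"

lemma part_dist_zero_unique:
  assumes "v \<in> vertices m" "part_dist m i v = 0" "part_dist m j v = 0" "i \<le> m + 1" "j \<le> m + 1"
  shows "i = j"
  using assms by (cases v) (auto split: if_splits)

lemma ex_part_dist_zero:
  assumes "1 \<le> m" "v \<in> vertices m"
  shows "\<exists>j \<le> m + 1. part_dist m j v = 0"
  using assms(2)
proof (cases v)
  case Tip
  then show ?thesis by (intro exI[of _ "m + 1"]) simp
next
  case Twin
  then show ?thesis using assms by (intro exI[of _ 1]) simp
next
  case (Fan i)
  then show ?thesis using assms by (intro exI[of _ i]) simp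
qed (auto intro!: exI[of _ 0])

lemma part_nonempty:
  assumes "1 \<le> m" "j \<le> m + 1"
  shows "part m j \<noteq> {}"
proof -
  consider "j = 0" | "1 \<le> j" "j \<le> m" | "j = m + 1"
    using assms by linarith
  then have "\<exists>v. v \<in> part m j"
  proof cases
    case 1
    then show ?thesis by (intro exI[of _ Hub]) (simp add: part_def)
  next
    case 2
    then show ?thesis by (intro exI[of _ "Fan j"]) (simp add: part_def)
  next
    case 3
    then show ?thesis by (intro exI[of _ Tip]) (simp add: part_def)
  qed
  then show ?thesis by blast
qed

lemma inj_on_part:
  assumes "1 \<le> m"
  shows "inj_on (\<lambda>j. to_nat ` part m j) {..m + 1}"
proof (rule inj_onI)
  fix i j assume ij: "i \<in> {..m + 1}" "j \<in> {..m + 1}" "to_nat ` part m i = to_nat ` part m j"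
  then have "part m i = part m j"
    by (simp add: inj_image_eq_iff)
  then obtain v where "v \<in> part m i" "v \<in> part m j"
    using part_nonempty[OF assms, of i] ij by blast
  then show "i = j"
    using part_dist_zero_unique ij by (auto simp: part_def)
qed

lemma card_parts: "1 \<le> m \<Longrightarrow> card (parts m) = m + 2"
  unfolding parts_def using card_image[OF inj_on_part] by simp

lemma partition_on_parts:
  assumes "1 \<le> m"
  shows "partition_on (pverts (witness m)) (parts m)"
proof (rule partition_onI)
  show "\<Union> (parts m) = pverts (witness m)"
    using ex_part_dist_zero[OF assms] by (fastforce simp: parts_def part_def)
  show "{} \<notin> parts m"
    using part_nonempty[OF assms] by (auto simp: parts_def)
  show "disjnt p q" if pq: "p \<in> parts m" "q \<in> parts m" "p \<noteq> q" for p q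
  proof -
    obtain i j where ij: "i \<le> m + 1" "j \<le> m + 1" "p = to_nat ` part m i" "q = to_nat ` part m j"
      using pq by (auto simp: parts_def)
    with pq(3) have "i \<noteq> j"
      by blast
    with ij show ?thesis
      using part_dist_zero_unique[of _ m i j] by (auto simp: disjnt_def part_def)
  qed
qed

definition dist_count :: "nat \<Rightarrow> nat \<Rightarrow> vertex \<Rightarrow> nat" where
  "dist_count m c v = card {j. j \<le> m + 1 \<and> part_dist m j v = c}"

text \<open>Distinct indices give distinct parts, so multiplicities can be counted over
  indices.\<close>

lemma count_mp_representation_parts:
  assumes "3 \<le> m" "v \<in> vertices m"
  shows "count (mp_representation (witness m) (parts m) (to_nat v)) (ereal (real c)) = dist_count m c v"
proof -
  have "mp_representation (witness m) (parts m) (to_nat v) =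
      image_mset (\<lambda>j. dist_to_part (witness m) (to_nat v) (to_nat ` part m j)) (mset_set {..m + 1})"
    unfolding mp_representation_def parts_def using assms inj_on_part[of m]
    by (subst image_mset_mset_set[symmetric]) (simp_all add: multiset.map_comp comp_def)
  also have "\<dots> = image_mset (\<lambda>j. ereal (real (part_dist m j v))) (mset_set {..m + 1})"
    by (rule image_mset_cong) (use assms dist_to_part_part in auto)
  finally show ?thesis
    by (auto simp: count_image_mset dist_count_def intro!: arg_cong[of _ _ card])
qed

lemma dist_count_5:
  "dist_count m 5 Twin = 1" "dist_count m 5 Tip = 0" "dist_count m 5 Stem = 0" "dist_count m 5 Hub = 0"
  "dist_count m 5 Bridge = 0" "dist_count m 5 (Clique i) = 0" "dist_count m 5 (Fan i) = 0"
proof -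
  have "{j. j \<le> m + 1 \<and> part_dist m j Twin = 5} = {m + 1}"
    by (auto split: if_splits)
  then show "dist_count m 5 Twin = 1"
    by (simp add: dist_count_def)
qed (auto simp: dist_count_def)

lemma dist_count_4:
  assumes "1 \<le> m" "i \<le> m"
  shows "dist_count m 4 Tip = m" "dist_count m 4 Stem = 0" "dist_count m 4 Hub = 0"
    "dist_count m 4 Bridge = 1" "dist_count m 4 (Clique i) = 0" "dist_count m 4 (Fan i) = 1"
proof -
  have "{j. j \<le> m + 1 \<and> part_dist m j Tip = 4} = {1..m}"
    "{j. j \<le> m + 1 \<and> part_dist m j Bridge = 4} = {m + 1}"
    "{j. j \<le> m + 1 \<and> part_dist m j (Fan i) = 4} = {m + 1}"
    by (auto split: if_splits)
  then show "dist_count m 4 Tip = m" "dist_count m 4 Bridge = 1" "dist_count m 4 (Fan i) = 1"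
    by (simp_all add: dist_count_def)
qed (auto simp: dist_count_def)

lemma dist_count_3:
  assumes "3 \<le> m" "i \<le> m"
  shows "dist_count m 3 Stem = m" "dist_count m 3 Hub = 0"
    "dist_count m 3 Bridge > 0" "dist_count m 3 (Clique i) = 1" "dist_count m 3 (Fan i) = 0"
proof -
  have "{j. j \<le> m + 1 \<and> part_dist m j Stem = 3} = {1..m}"
    "{j. j \<le> m + 1 \<and> part_dist m j (Clique i) = 3} = {m + 1}"
    by (auto split: if_splits)
  then show "dist_count m 3 Stem = m" "dist_count m 3 (Clique i) = 1"
    by (simp_all add: dist_count_def)
  \<comment> \<open>Index 2 qualifies because \<open>3 \<le> m\<close> gives
    \<open>2 * 2 < m + 2\<close>.\<close>
  have "2 \<in> {j. j \<le> m + 1 \<and> part_dist m j Bridge = 3}"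
    using assms by simp
  moreover have "finite {j. j \<le> m + 1 \<and> part_dist m j Bridge = 3}"
    by simp
  ultimately show "dist_count m 3 Bridge > 0"
    unfolding dist_count_def card_gt_0_iff by blast
qed (auto simp: dist_count_def)

lemma dist_count_1_Clique:
  assumes "i \<le> m"
  shows "dist_count m 1 (Clique i) = i"
proof -
  have "{j. j \<le> m + 1 \<and> part_dist m j (Clique i) = 1} = {1..i}"
    using assms by (auto split: if_splits)
  then show ?thesis
    by (simp add: dist_count_def)
qed

text \<open>The clique part contributes 1 and the threshold range \<open>{m + 2 - i..m}\<close>
  contributes \<open>i - 1\<close>. When the range contains \<open>i\<close> itself, that lost index
  is made up for by index 1, reached through \<open>Twin\<close>.\<close>

lemma dist_count_1_Fan:
  assumes "1 \<le> i" "i \<le> m"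
  shows "dist_count m 1 (Fan i) = i"
proof (cases "m + 2 \<le> 2 * i")
  case True
  then have "{j. j \<le> m + 1 \<and> part_dist m j (Fan i) = 1} = {0, 1} \<union> ({m + 2 - i..m} - {i})"
    using assms by (auto split: if_splits)
  moreover have "card ({0, 1} \<union> ({m + 2 - i..m} - {i})) = i"
    using assms True by (subst card_Un_disjoint) (auto simp: card_Diff_singleton)
  ultimately show ?thesis
    by (simp add: dist_count_def)
next
  case False
  then have "{j. j \<le> m + 1 \<and> part_dist m j (Fan i) = 1} = {0} \<union> {m + 2 - i..m}"
    using assms by (auto split: if_splits)
  moreover have "card ({0} \<union> {m + 2 - i..m}) = i"
    using assms by (subst card_Un_disjoint) auto
  ultimately show ?thesis
    by (simp add: dist_count_def)
qed

text \<open>The multiplicity of 5 isolates \<open>Twin\<close>. That of 4 splits the rest into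
  \<open>Tip\<close>, then \<open>Bridge\<close> with the fan, then \<open>Stem\<close> and
  \<open>Hub\<close> with the clique. That of 3 isolates \<open>Bridge\<close>, \<open>Stem\<close>
  and \<open>Hub\<close> in their classes, and that of 1 reads off the index in the clique or the
  fan.\<close>

lemma resolving_parts:
  assumes "3 \<le> m"
  shows "resolving_multiset_partition (witness m) (parts m)"
  unfolding resolving_multiset_partition_def
proof (intro conjI ballI impI)
  show "partition_on (pverts (witness m)) (parts m)"
    using assms by (intro partition_on_parts) simp
  fix x y assume xy: "x \<in> pverts (witness m)" "y \<in> pverts (witness m)" "x \<noteq> y"
  then obtain u v where uv: "u \<in> vertices m" "v \<in> vertices m" "x = to_nat u" "y = to_nat v" "u \<noteq> v"
    by auto
  show "mp_representation (witness m) (parts m) x \<noteq> mp_representation (witness m) (parts m) y"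
  proof
    assume "mp_representation (witness m) (parts m) x = mp_representation (witness m) (parts m) y"
    then have eq: "dist_count m c u = dist_count m c v" for c
      using count_mp_representation_parts[OF assms] uv by metis
    have Bridge: "dist_count m 3 Bridge \<noteq> 0"
      using dist_count_3(3)[OF assms, of 0] by simp
    show False
      using uv(1,2,5) eq[of 5] eq[of 4] eq[of 3] eq[of 1] assms Bridge
      by (cases u; cases v)
         (auto simp: dist_count_5 dist_count_4 dist_count_3 dist_count_1_Clique dist_count_1_Fan
           simp del: One_nat_def)
  qed
qed

section \<open>Lower bound: every resolving partition has at least \<open>m + 2\<close>
  parts\<close>

text \<open>\<open>Clique 0\<close> reaches \<open>Twin\<close> through \<open>Bridge\<close>, the
  other clique vertices through \<open>Fan 1\<close>, and \<open>Fan 1\<close> reaches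
  \<open>Bridge\<close> through \<open>Twin\<close>. \<open>Clique m\<close> serves as the link to
  fan vertices.\<close>

lemma within_two:
  assumes "3 \<le> m" "u \<in> Clique ` {..m} \<union> {Fan 1}" "w \<in> vertices m - {Stem, Tip}"
  shows "u = w \<or> adj m u w \<or> (\<exists>c\<in>vertices m. adj m u c \<and> adj m c w)"
proof -
  have X: ?thesis if "u = Clique i" "i \<le> m" for i
  proof (cases w)
    case Twin
    then show ?thesis using that assms
      by (intro disjI2 bexI[of _ "if i = 0 then Bridge else Fan 1"]) (auto simp: adj_def)
  next
    case Bridge
    then show ?thesis using that assms
      by (cases "i = 0") (auto simp: adj_def intro!: bexI[of _ "Clique 0"])
  next
    case (Fan j)
    then show ?thesis using that assms
      by (cases "i = m") (auto simp: adj_def intro!: bexI[of _ "Clique m"])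
  qed (use that assms in \<open>auto simp: adj_def\<close>)
  have Y: ?thesis if "u = Fan 1"
  proof (cases w)
    case Hub
    then show ?thesis using that assms
      by (intro disjI2 bexI[of _ "Clique 1"]) (auto simp: adj_def)
  next
    case Bridge
    then show ?thesis using that assms
      by (intro disjI2 bexI[of _ Twin]) (auto simp: adj_def)
  next
    case (Clique j)
    then show ?thesis using that assms
      by (cases "j = 0") (auto simp: adj_def intro!: bexI[of _ "Clique 1"])
  next
    case (Fan j)
    then show ?thesis using that assms
      by (intro disjI2 bexI[of _ "Clique m"]) (auto simp: adj_def)
  qed (use that assms in \<open>auto simp: adj_def\<close>)
  show ?thesis
    using assms(2) X Y by auto
qed

lemma dist_to_part_near:
  assumes "3 \<le> m" "u \<in> Clique ` {..m} \<union> {Fan 1}" "S \<subseteq> pverts (witness m)" "\<not> S \<subseteq> to_nat ` {Stem, Tip}"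
  shows "\<exists>n \<le> 2. dist_to_part (witness m) (to_nat u) S = ereal (real n) \<and> (n = 0 \<longleftrightarrow> to_nat u \<in> S)"
proof -
  interpret pair_graph "witness m"
    by (rule pair_graph_witness)
  obtain w where w: "w \<in> vertices m - {Stem, Tip}" "to_nat w \<in> S"
    using assms(3,4) by auto
  have u: "u \<in> vertices m"
    using assms(1,2) by auto
  obtain p where p: "length p \<le> 2" "awalk (to_nat u) p (to_nat w)"
  proof -
    from within_two[OF assms(1,2) w(1)]
    consider "u = w" | "adj m u w" | c where "c \<in> vertices m" "adj m u c" "adj m c w"
      by blast
    then show ?thesis
    proof cases
      case 1
      then show ?thesis using u by (intro that[of "[]"]) (auto simp: awalk_Nil_iff)
    next
      case 2
      then show ?thesis using u w
        by (intro that[of "[(to_nat u, to_nat w)]"]) (auto simp: awalk_Nil_iff awalk_Cons_iff)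
    next
      case 3
      then show ?thesis using u w
        by (intro that[of "[(to_nat u, to_nat c), (to_nat c, to_nat w)]"])
           (auto simp: awalk_Nil_iff awalk_Cons_iff)
    qed
  qed
  show ?thesis
    using dist_to_part_le_walk[OF pair_graph_witness assms(3) w(2) p(2)] p(1) le_trans by blast
qed

lemma dist_to_part_far:
  assumes "3 \<le> m" "i \<le> m" "S \<subseteq> to_nat ` {Stem, Tip}" "S \<noteq> {}"
  shows "dist_to_part (witness m) (to_nat (Clique i)) S = ereal (real (if to_nat Stem \<in> S then 2 else 3))"
proof -
  obtain T where T: "T \<subseteq> {Stem, Tip}" "S = to_nat ` T"
    using assms(3) by (metis subset_imageE)
  have mem: "to_nat v \<in> S \<longleftrightarrow> v \<in> T" for v
    using T(2) by (simp add: inj_image_mem_iff)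
  have PQ: "Stem \<in> T \<or> Tip \<in> T"
    using T assms(4) by auto
  \<comment> \<open>\<open>part_dist m (m + 1)\<close> is the distance to \<open>Tip\<close>. Walks
    to \<open>Tip\<close> from elsewhere pass \<open>Stem\<close>, so values drop by one when
    \<open>Stem\<close> is a target; \<open>Tip\<close> itself then has value 1 unless it is a
    target too.\<close>
  define h where "h v = (if v \<in> T then 0 else if v = Tip then 1
      else part_dist m (m + 1) v - (if Stem \<in> T then 1 else 0))" for v
  have "dist_to_part (witness m) (to_nat (Clique i)) (to_nat ` T) = ereal (real (h (Clique i)))"
  proof (rule dist_to_part_witness)
    show "T \<subseteq> vertices m"
      using T(1) by auto
    show "h v = 0 \<longleftrightarrow> v \<in> T" if "v \<in> vertices m" for v
      using that T(1) PQ by (cases v) (auto simp: h_def)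
    show "h u \<le> Suc (h v) \<and> h v \<le> Suc (h u)" if "u \<in> vertices m" "v \<in> vertices m" "half_adj m u v" for u v
      using that T(1) PQ by (cases u; cases v) (auto simp: h_def)
    show "\<exists>w\<in>vertices m. adj m v w \<and> h v = Suc (h w)" if "v \<in> vertices m" "h v \<noteq> 0" for v
    proof -
      have "v \<notin> T"
        using that by (auto simp: h_def)
      define w where "w = (case v of Stem \<Rightarrow> Tip | Tip \<Rightarrow> Stem | Hub \<Rightarrow> Stem | Twin \<Rightarrow> Bridge | Bridge \<Rightarrow> Clique 0
          | Clique i \<Rightarrow> Hub | Fan i \<Rightarrow> Clique m)"
      show ?thesis
        using that T(1) PQ \<open>v \<notin> T\<close>
        by (intro bexI[of _ w]) (cases v; force simp: h_def w_def adj_def)+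
    qed
  qed (use assms in auto)
  moreover have "h (Clique i) = (if Stem \<in> T then 2 else 3)"
    using T(1) by (auto simp: h_def)
  ultimately show ?thesis
    unfolding mem using T(2) by simp
qed

lemma resolving_card_ge:
  assumes "3 \<le> m" and res: "resolving_multiset_partition (witness m) P"
  shows "m + 2 \<le> card P"
proof -
  let ?O = "to_nat ` {Stem, Tip}"
  define A where "A = {S\<in>P. \<not> S \<subseteq> ?O}"
  have part: "partition_on (pverts (witness m)) P"
    using res unfolding resolving_multiset_partition_def by simp
  have sub: "S \<subseteq> pverts (witness m)" "S \<noteq> {}" if "S \<in> P" for S
    using part that by (auto simp: partition_on_def)
  have fin: "finite P"
    using part by (rule finite_elements[rotated]) simp
  have A: "A \<subseteq> P"
    by (auto simp: A_def)
  have le: "card (to_nat ` U) \<le> card A"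
    if U: "U \<subseteq> Clique ` {..m} \<union> {Fan 1}" and const: "P = A \<or> U \<subseteq> Clique ` {..m}" for U
  proof (rule card_le_card_near_parts[OF res fin A])
    have UV: "U \<subseteq> vertices m - {Stem, Tip}"
      using U assms(1) by auto
    then show "to_nat ` U \<subseteq> pverts (witness m)"
      by auto
    show "\<exists>S\<in>A. x \<in> S" if x: "x \<in> to_nat ` U" for x
    proof -
      obtain v where v: "v \<in> vertices m" "v \<notin> {Stem, Tip}" "x = to_nat v"
        using x UV by blast
      then obtain S where "S \<in> P" "x \<in> S"
        using partition_onD1[OF part] by (metis UnionE image_eqI pverts_witness)
      moreover have "x \<notin> ?O"
        using v by auto
      ultimately show ?thesis
        unfolding A_def by blast
    qed
    show "\<exists>n \<le> 2. dist_to_part (witness m) x S = ereal (real n) \<and> (n = 0 \<longleftrightarrow> x \<in> S)"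
      if xS: "x \<in> to_nat ` U" "S \<in> A" for x S
    proof -
      obtain u where u: "u \<in> U" "x = to_nat u"
        using xS(1) by blast
      have "S \<in> P" "\<not> S \<subseteq> ?O"
        using xS(2) by (simp_all add: A_def)
      with u U show ?thesis
        using dist_to_part_near[OF assms(1) _ sub(1)] by blast
    qed
    show "dist_to_part (witness m) x S = dist_to_part (witness m) y S"
      if xy: "x \<in> to_nat ` U" "y \<in> to_nat ` U" "S \<in> P - A" for x y S
    proof -
      have "U \<subseteq> Clique ` {..m}" and S: "S \<subseteq> ?O" "S \<noteq> {}"
        using const xy(3) sub by (auto simp: A_def)
      then obtain i i' where "x = to_nat (Clique i)" "i \<le> m" "y = to_nat (Clique i')" "i' \<le> m"
        using xy(1,2) by blast
      then show ?thesis
        by (simp add: dist_to_part_far[OF assms(1) _ S])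
    qed
  qed
  have card_to_nat: "card (to_nat ` U) = card U" for U :: "vertex set"
    by (simp add: card_image)
  have card_X: "card (Clique ` {..m}) = m + 1"
    by (simp add: card_image inj_on_def)
  show ?thesis
  proof (cases "P = A")
    case True
    have "card (Clique ` {..m} \<union> {Fan 1}) = m + 2"
      using card_X by (subst card_Un_disjoint) auto
    moreover have "card (to_nat ` (Clique ` {..m} \<union> {Fan 1})) \<le> card A"
      using True by (intro le) auto
    ultimately show ?thesis
      using card_to_nat[of "Clique ` {..m} \<union> {Fan 1}"] arg_cong[OF True, of card] by linarith
  next
    case False
    then have "card A < card P"
      using A fin by (intro psubset_card_mono) auto
    moreover have "card (to_nat ` Clique ` {..m}) \<le> card A"
      by (rule le) auto
    ultimately show ?thesis
      using card_X card_to_nat[of "Clique ` {..m}"] by linarith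
  qed
qed

theorem theorem2p3:
  fixes k :: nat
  assumes "k \<ge> 6"
  shows "\<exists>G :: nat pair_pre_digraph.
           pair_graph G \<and> Digraph_Component.connected (with_proj G) \<and> mpd G = enat k"
proof -
  define m where "m = k - 2"
  have m: "3 \<le> m" "k = m + 2"
    using assms by (simp_all add: m_def)
  have "mpd (witness m) = enat k"
    unfolding mpd_def
  proof (rule antisym)
    show "Inf {enat (card P) | P. resolving_multiset_partition (witness m) P} \<le> enat k"
      using resolving_parts[OF m(1)] card_parts[of m] m by (intro Inf_lower) force
    show "enat k \<le> Inf {enat (card P) | P. resolving_multiset_partition (witness m) P}"
      using resolving_card_ge[OF m(1)] m(2) by (intro Inf_greatest) auto
  qed
  then show ?thesis
    using pair_graph_witness connected_witness[OF m(1)] by blast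
qed

end
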